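(* Let $B$ be a $k$-stacked homology ball. Then all the missing faces of $B$ have dimension $\leq k$.
   Context: Simplicial complexes are finite and contain the empty set as a face. A missing face of dimension $l$ of a complex $X$ is a set $\alpha$ of $l+1$ vertices of $X$ such that $\alpha$ is not a face of $X$ but all proper subsets of $\alpha$ are faces of $X$. A homology ball means an $\mathbb{F}$-homology ball for some field $\mathbb{F}$. An $\mathbb{F}$-homology $d$-sphere is a $d$-dimensional complex in which the link of every face $\sigma$ (including $\emptyset$) has the reduced $\mathbb{F}$-homology of a $(d-\dim(\sigma)-1)$-sphere. An $\mathbb{F}$-homology $d$-ball is a $d$-dimensional $\mathbb{F}$-acyclic complex in which the link of every non-empty face $\sigma$ has the reduced homology of a $(d-\dim(\sigma)-1)$-sphere or of a point, and whose faces with acyclic link form an $\mathbb{F}$-homology $(d-1)$-sphere (its boundary; equivalently the pure subcomplex whose facets are the $(d-1)$-faces lying in exactly one facet). For $0\le k\le d+1$, a homology $(d+1)$-ball is $k$-stacked if all its faces of codimension at least $k+1$ (dimension $\le d-k$) lie in its boundary. *)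

theory Defs
  imports Complex_Main "HOL-Library.Function_Algebras"
begin

definition simplicial_complex :: "'v set set \<Rightarrow> bool" where
  "simplicial_complex X \<longleftrightarrow>
     finite X \<and> {} \<in> X \<and> (\<forall>\<sigma>\<in>X. finite \<sigma>) \<and> (\<forall>\<sigma>\<in>X. \<forall>\<tau>. \<tau> \<subseteq> \<sigma> \<longrightarrow> \<tau> \<in> X)"

definition vertices :: "'v set set \<Rightarrow> 'v set" where
  "vertices X = \<Union>X"

text \<open>Dimensions are integers, since the empty face has dimension \<open>-1\<close>.\<close>

definition face_dim :: "'v set \<Rightarrow> int" where
  "face_dim \<sigma> = int (card \<sigma>) - 1"

definition complex_dim :: "'v set set \<Rightarrow> int" where
  "complex_dim X = Max (face_dim ` X)"

definition link :: "'v set set \<Rightarrow> 'v set \<Rightarrow> 'v set set" where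
  "link X \<sigma> = {\<tau> \<in> X. \<sigma> \<inter> \<tau> = {} \<and> \<sigma> \<union> \<tau> \<in> X}"

definition missing_face :: "'v set set \<Rightarrow> 'v set \<Rightarrow> bool" where
  "missing_face X \<alpha> \<longleftrightarrow> \<alpha> \<subseteq> vertices X \<and> \<alpha> \<notin> X \<and> (\<forall>\<beta>. \<beta> \<subset> \<alpha> \<longrightarrow> \<beta> \<in> X)"

section \<open>Reduced simplicial homology over a field\<close>

text \<open>
  Oriented chains in the sense of Munkres: an \<open>i\<close>-chain assigns to every ordered list of the
  \<open>i + 1\<close> vertices of an \<open>i\<close>-face a coefficient that changes sign under a transposition of
  neighbouring entries (hence under every odd permutation), and vanishes on all other lists.
  No linear order on the vertices is needed. The empty list carries the chains of degree \<open>-1\<close>,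
  which makes the homology reduced.
\<close>

definition oriented_chains :: "'v set set \<Rightarrow> int \<Rightarrow> ('v list \<Rightarrow> 'f::field) set" where
  "oriented_chains X i = {c.
     (\<forall>xs. c xs \<noteq> 0 \<longrightarrow> distinct xs \<and> set xs \<in> X \<and> int (length xs) = i + 1) \<and>
     (\<forall>xs ys a b. c (xs @ a # b # ys) = - c (xs @ b # a # ys))}"

text \<open>
  This is the usual \<open>\<partial>[v\<^sub>0,\<dots>,v\<^sub>i] = (\<Sum>j. (-1)\<^sup>j [v\<^sub>0,\<dots>,v\<^sub>j\<^sub>-\<^sub>1,v\<^sub>j\<^sub>+\<^sub>1,\<dots>,v\<^sub>i])\<close> read off coefficientwise:
  each face containing \<open>set xs\<close> as a facet can be oriented as \<open>v # xs\<close>, and then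
  contributes \<open>xs\<close> with sign \<open>+1\<close>. At \<open>xs = []\<close> it is the augmentation.
\<close>

definition bdry_op :: "'v set set \<Rightarrow> ('v list \<Rightarrow> 'f::field) \<Rightarrow> 'v list \<Rightarrow> 'f" where
  "bdry_op X c = (\<lambda>xs. \<Sum>v\<in>vertices X. c (v # xs))"

definition cycles :: "'v set set \<Rightarrow> int \<Rightarrow> ('v list \<Rightarrow> 'f::field) set" where
  "cycles X i = {c \<in> oriented_chains X i. bdry_op X c = 0}"

definition boundaries :: "'v set set \<Rightarrow> int \<Rightarrow> ('v list \<Rightarrow> 'f::field) set" where
  "boundaries X i = bdry_op X ` oriented_chains X (i + 1)"

lemma sum_antisymmetric_eq_0:
  fixes f :: "'a \<Rightarrow> 'a \<Rightarrow> 'f::field"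
  assumes "finite A" "\<And>a. f a a = 0" "\<And>a b. f a b = - f b a"
  shows "(\<Sum>a\<in>A. \<Sum>b\<in>A. f a b) = 0"
  using assms(1)
proof (induction A rule: finite_induct)
  case (insert x A)
  have "(\<Sum>a\<in>A. f a x) = - (\<Sum>b\<in>A. f x b)"
    unfolding sum_negf[symmetric] by (rule sum.cong[OF refl]) (rule assms(3))
  then show ?case
    using insert by (simp add: sum.distrib assms(2))
qed simp

lemma boundaries_subset_cycles:
  assumes "simplicial_complex X"
  shows "boundaries X i \<subseteq> (cycles X i :: ('v list \<Rightarrow> 'f::field) set)"
proof
  fix b :: "'v list \<Rightarrow> 'f"
  assume "b \<in> boundaries X i"
  then obtain c where b: "b = bdry_op X c" and c: "c \<in> oriented_chains X (i + 1)"
    by (auto simp: boundaries_def)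
  have supp: "distinct xs \<and> set xs \<in> X \<and> int (length xs) = i + 1 + 1" if "c xs \<noteq> 0" for xs
    using c that unfolding oriented_chains_def by blast
  have alt: "c (xs @ x # y # ys) = - c (xs @ y # x # ys)" for xs ys x y
    using c unfolding oriented_chains_def by blast
  have fin: "finite (vertices X)"
    using assms by (auto simp: simplicial_complex_def vertices_def)
  have "distinct xs \<and> set xs \<in> X \<and> int (length xs) = i + 1" if "b xs \<noteq> 0" for xs
  proof -
    have "b xs = 0" if "\<forall>v. c (v # xs) = 0"
      using that by (simp add: b bdry_op_def)
    with that have "\<not> (\<forall>v. c (v # xs) = 0)"
      by blast
    then obtain v where "c (v # xs) \<noteq> 0"
      by blast
    with supp[of "v # xs"] assms show ?thesis
      by (auto simp: simplicial_complex_def)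
  qed
  moreover have "b (xs @ x # y # ys) = - b (xs @ y # x # ys)" for xs ys x y
  proof -
    have "c (v # xs @ x # y # ys) = - c (v # xs @ y # x # ys)" for v
      by (rule alt[of "v # xs", unfolded append_Cons])
    then show ?thesis
      unfolding b bdry_op_def sum_negf[symmetric] by (rule sum.cong[OF refl])
  qed
  moreover have "bdry_op X b = 0"
  proof -
    have "c (v # v # xs) = 0" for v xs
      using supp[of "v # v # xs"] by auto
    moreover have "c (w # v # xs) = - c (v # w # xs)" for v w xs
      by (rule alt[of "[]", unfolded append_Nil])
    ultimately show ?thesis
      unfolding b bdry_op_def zero_fun_def by (intro ext sum_antisymmetric_eq_0[OF fin])
  qed
  ultimately show "b \<in> cycles X i"
    unfolding cycles_def oriented_chains_def by blast
qed

definition fun_scale :: "'f::field \<Rightarrow> ('a \<Rightarrow> 'f) \<Rightarrow> 'a \<Rightarrow> 'f" where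
  "fun_scale a c = (\<lambda>x. a * c x)"

global_interpretation fun_vs: vector_space fun_scale
  by unfold_locales (auto simp: fun_scale_def fun_eq_iff algebra_simps)

text \<open>
  The dimension over \<open>'f\<close> of the quotient of cycles by boundaries. Both spaces are
  finite-dimensional for a finite complex, and the second is contained in the first
  (lemma \<open>boundaries_subset_cycles\<close>), so the subtraction does not truncate.
\<close>

definition reduced_betti :: "'f::field itself \<Rightarrow> 'v set set \<Rightarrow> int \<Rightarrow> nat" where
  "reduced_betti F X i =
     fun_vs.dim (cycles X i :: ('v list \<Rightarrow> 'f) set) - fun_vs.dim (boundaries X i :: ('v list \<Rightarrow> 'f) set)"

definition acyclic_complex :: "'f::field itself \<Rightarrow> 'v set set \<Rightarrow> bool" where
  "acyclic_complex F X \<longleftrightarrow> (\<forall>i. reduced_betti F X i = 0)"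

definition has_homology_of_sphere :: "'f::field itself \<Rightarrow> int \<Rightarrow> 'v set set \<Rightarrow> bool" where
  "has_homology_of_sphere F n X \<longleftrightarrow> (\<forall>i. reduced_betti F X i = (if i = n then 1 else 0))"

section \<open>Homology spheres and balls\<close>

definition homology_sphere :: "'f::field itself \<Rightarrow> int \<Rightarrow> 'v set set \<Rightarrow> bool" where
  "homology_sphere F d X \<longleftrightarrow> simplicial_complex X \<and> complex_dim X = d \<and>
     (\<forall>\<sigma>\<in>X. has_homology_of_sphere F (d - face_dim \<sigma> - 1) (link X \<sigma>))"

text \<open>The empty face belongs to the boundary of a ball, its link being the whole acyclic complex.\<close>

definition ball_boundary :: "'f::field itself \<Rightarrow> 'v set set \<Rightarrow> 'v set set" where
  "ball_boundary F X = {\<sigma> \<in> X. acyclic_complex F (link X \<sigma>)}"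

definition homology_ball :: "'f::field itself \<Rightarrow> int \<Rightarrow> 'v set set \<Rightarrow> bool" where
  "homology_ball F d X \<longleftrightarrow> simplicial_complex X \<and> complex_dim X = d \<and> acyclic_complex F X \<and>
     (\<forall>\<sigma>\<in>X. \<sigma> \<noteq> {} \<longrightarrow>
        has_homology_of_sphere F (d - face_dim \<sigma> - 1) (link X \<sigma>) \<or> acyclic_complex F (link X \<sigma>)) \<and>
     homology_sphere F (d - 1) (ball_boundary F X)"

text \<open>Here \<open>d + 1\<close> is the dimension of the ball, so its faces of codimension at least \<open>k + 1\<close> are those of dimension at most \<open>d - k\<close>.\<close>

definition k_stacked_ball :: "'f::field itself \<Rightarrow> int \<Rightarrow> int \<Rightarrow> 'v set set \<Rightarrow> bool" where
  "k_stacked_ball F d k B \<longleftrightarrow> homology_ball F (d + 1) B \<and> 0 \<le> k \<and> k \<le> d + 1 \<and>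
     (\<forall>\<sigma>\<in>B. face_dim \<sigma> \<le> d - k \<longrightarrow> \<sigma> \<in> ball_boundary F B)"

end

theory Submission
  imports Defs
begin

text \<open>
  In a \<open>k\<close>-stacked ball, the link of a face of dimension at most \<open>d - k\<close> is acyclic, and the link
  of a larger face \<open>\<sigma>\<close> has at most the homology of a sphere of dimension
  \<open>d - dim \<sigma> < k\<close>. So the reduced homology of all links vanishes in degrees at least \<open>k\<close>: the ball
  is \<open>k\<close>-Leray. By a Mayer--Vietoris argument this property survives the deletion of a vertex
  \<open>v\<close>, because \<open>X\<close> is the union of \<open>X - v\<close> and a cone, along the link of \<open>v\<close>. Hence it passes to
  induced subcomplexes. On the vertices of a missing face of dimension \<open>l\<close> the ball induces the
  boundary of a simplex, which has homology in degree \<open>l - 1\<close>, whence \<open>l - 1 < k\<close>.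
\<close>

section \<open>Vanishing of homology in terms of chains\<close>

lemma oriented_chainsI:
  assumes "\<And>xs. c xs \<noteq> 0 \<Longrightarrow> distinct xs \<and> set xs \<in> X \<and> int (length xs) = i + 1"
    and "\<And>xs ys a b. c (xs @ a # b # ys) = - c (xs @ b # a # ys)"
  shows "c \<in> oriented_chains X i"
  using assms unfolding oriented_chains_def by blast

lemma oriented_chains_support:
  assumes "c \<in> oriented_chains X i" "c xs \<noteq> 0"
  shows "distinct xs" "set xs \<in> X" "int (length xs) = i + 1"
  using assms unfolding oriented_chains_def by blast+

lemma oriented_chains_swap:
  assumes "c \<in> oriented_chains X i"
  shows "c (xs @ a # b # ys) = - c (xs @ b # a # ys)"
  using assms unfolding oriented_chains_def by blast

lemma oriented_chains_mono: "X \<subseteq> Y \<Longrightarrow> oriented_chains X i \<subseteq> oriented_chains Y i"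
  unfolding oriented_chains_def by blast

lemma finite_vertices: "simplicial_complex X \<Longrightarrow> finite (vertices X)"
  by (auto simp: simplicial_complex_def vertices_def)

text \<open>Chains vanish on lists that leave the vertex set, so the sum may run over any larger
  finite set. Boundaries taken in a complex, a deletion and a link thus become comparable.\<close>

lemma bdry_op_superset:
  assumes "c \<in> oriented_chains X i" "vertices X \<subseteq> V" "finite V"
  shows "bdry_op X c xs = (\<Sum>v\<in>V. c (v # xs))"
  unfolding bdry_op_def
proof (rule sum.mono_neutral_left[OF assms(3,2)], safe)
  fix v assume "v \<notin> vertices X"
  then show "c (v # xs) = 0"
    using oriented_chains_support(2)[OF assms(1), of "v # xs"] by (auto simp: vertices_def)
qed

lemma subspace_oriented_chains:
  "fun_vs.subspace (oriented_chains X i :: ('v list \<Rightarrow> 'f::field) set)"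
proof (rule fun_vs.subspaceI)
  show "0 \<in> oriented_chains X i"
    by (rule oriented_chainsI) auto
next
  fix b c :: "'v list \<Rightarrow> 'f" assume bc: "b \<in> oriented_chains X i" "c \<in> oriented_chains X i"
  show "b + c \<in> oriented_chains X i"
  proof (rule oriented_chainsI)
    fix xs assume "(b + c) xs \<noteq> 0"
    then have "b xs \<noteq> 0 \<or> c xs \<noteq> 0" by auto
    then show "distinct xs \<and> set xs \<in> X \<and> int (length xs) = i + 1"
      using bc oriented_chains_support by blast
  next
    fix xs ys and x y :: 'v
    show "(b + c) (xs @ x # y # ys) = - (b + c) (xs @ y # x # ys)"
      using bc[THEN oriented_chains_swap, of xs x y ys] by simp
  qed
next
  fix a and c :: "'v list \<Rightarrow> 'f" assume c: "c \<in> oriented_chains X i"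
  show "fun_scale a c \<in> oriented_chains X i"
  proof (rule oriented_chainsI)
    fix xs assume "fun_scale a c xs \<noteq> 0"
    then show "distinct xs \<and> set xs \<in> X \<and> int (length xs) = i + 1"
      using oriented_chains_support[OF c, of xs] by (auto simp: fun_scale_def)
  next
    fix xs ys and x y :: 'v
    show "fun_scale a c (xs @ x # y # ys) = - fun_scale a c (xs @ y # x # ys)"
      using oriented_chains_swap[OF c, of xs x y ys] by (simp add: fun_scale_def)
  qed
qed

lemma bdry_op_add: "bdry_op X (b + c) = bdry_op X b + bdry_op X c"
  by (simp add: bdry_op_def fun_eq_iff sum.distrib)

lemma bdry_op_scale: "bdry_op X (fun_scale a c) = fun_scale a (bdry_op X c)"
  by (simp add: bdry_op_def fun_scale_def fun_eq_iff sum_distrib_left)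

lemma module_hom_bdry_op: "module_hom fun_scale fun_scale (bdry_op X)"
  by (intro module_hom.intro module_hom_axioms.intro fun_vs.module_axioms bdry_op_add bdry_op_scale)

lemma subspace_boundaries: "fun_vs.subspace (boundaries X i)"
  unfolding boundaries_def
  by (rule module_hom.subspace_image[OF module_hom_bdry_op subspace_oriented_chains])

lemma sum_fun_apply: "(\<Sum>y\<in>L. g y) x = (\<Sum>y\<in>L. g y x)"
  by (induction L rule: infinite_finite_induct) auto

text \<open>Indicator functions of finitely many lists span all chains. Finite dimension is needed
  to conclude anything from \<open>dim\<close>, since an infinite basis has \<open>card\<close>
  0.\<close>

lemma oriented_chains_subset_span_finite:
  assumes "simplicial_complex X"
  shows "\<exists>S :: ('v list \<Rightarrow> 'f::field) set. finite S \<and> oriented_chains X i \<subseteq> fun_vs.span S"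
proof -
  \<comment> \<open>For \<open>i < -1\<close> the truncation gives \<open>L = {[]}\<close>, which is
    harmless: all chains of such degree are zero.\<close>
  define L where "L = {xs :: 'v list. set xs \<subseteq> vertices X \<and> length xs = nat (i + 1)}"
  define \<delta> :: "'v list \<Rightarrow> 'v list \<Rightarrow> 'f" where "\<delta> = (\<lambda>ys xs. if xs = ys then 1 else 0)"
  have L: "finite L"
    unfolding L_def by (rule finite_lists_length_eq[OF finite_vertices[OF assms]])
  have "c \<in> fun_vs.span (\<delta> ` L)" if c: "c \<in> oriented_chains X i" for c
  proof -
    have "c xs = 0" if "xs \<notin> L" for xs
      using oriented_chains_support[OF c, of xs] that by (force simp: L_def vertices_def)
    then have "c = (\<Sum>ys\<in>L. fun_scale (c ys) (\<delta> ys))"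
      using L by (auto simp: fun_eq_iff sum_fun_apply fun_scale_def \<delta>_def if_distrib cong: if_cong)
    also have "\<dots> \<in> fun_vs.span (\<delta> ` L)"
      by (intro fun_vs.span_sum fun_vs.span_scale fun_vs.span_base imageI)
    finally show ?thesis .
  qed
  with L show ?thesis by blast
qed

text \<open>A basis of \<open>U\<close> extends to a finite basis of \<open>W\<close>; by the
  dimension bound nothing is added.\<close>

lemma (in vector_space) subset_subspace_if_dim_le:
  assumes "subspace U" "U \<subseteq> W" "W \<subseteq> span S" "finite S" "dim W \<le> dim U"
  shows "W \<subseteq> U"
proof -
  obtain b where b: "b \<subseteq> U" "independent b" "U \<subseteq> span b" "card b = dim U"
    using basis_exists by blast
  obtain b' where b': "b \<subseteq> b'" "b' \<subseteq> W" "independent b'" "W \<subseteq> span b'"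
    using maximal_independent_subset_extend[of b W] b assms(2) by blast
  have "finite b'"
    using independent_span_bound[of S b'] assms b' by blast
  moreover have "card b' = dim W"
    using b' basis_card_eq_dim by blast
  ultimately have "b = b'"
    using b' b assms(5) by (metis card_subset_eq card_mono le_antisym)
  then show ?thesis
    using b b' span_minimal[OF b(1) assms(1)] by blast
qed

text \<open>A vanishing difference of naturals says that \<open>dim\<close> of the cycles is at most
  \<open>dim\<close> of the boundaries. As boundaries are cycles, the two spaces coincide, and the
  later arguments can work with chains alone.\<close>

lemma cycles_subset_boundaries:
  assumes "simplicial_complex X" "reduced_betti TYPE('f::field) X i = 0"
  shows "cycles X i \<subseteq> (boundaries X i :: ('v list \<Rightarrow> 'f) set)"
proof -
  obtain S :: "('v list \<Rightarrow> 'f) set" where S: "finite S" "oriented_chains X i \<subseteq> fun_vs.span S"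
    using oriented_chains_subset_span_finite[OF assms(1)] by blast
  then have "cycles X i \<subseteq> fun_vs.span S"
    by (auto simp: cycles_def)
  with S(1) show ?thesis
    using assms(2) unfolding reduced_betti_def
    by (intro fun_vs.subset_subspace_if_dim_le[OF subspace_boundaries boundaries_subset_cycles[OF assms(1)]])
      auto
qed

section \<open>Deletion of vertices\<close>

definition deletion :: "'v set set \<Rightarrow> 'v \<Rightarrow> 'v set set" where
  "deletion X v = {\<sigma> \<in> X. v \<notin> \<sigma>}"

lemma simplicial_complex_deletion: "simplicial_complex X \<Longrightarrow> simplicial_complex (deletion X v)"
  by (auto simp: simplicial_complex_def deletion_def)

lemma simplicial_complex_link:
  assumes "simplicial_complex X" "\<sigma> \<in> X"
  shows "simplicial_complex (link X \<sigma>)"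
  unfolding simplicial_complex_def
proof (intro conjI ballI allI impI)
  show "finite (link X \<sigma>)" "{} \<in> link X \<sigma>"
    using assms by (auto simp: simplicial_complex_def link_def)
  fix \<tau> assume "\<tau> \<in> link X \<sigma>"
  then have \<tau>: "\<tau> \<in> X" "\<sigma> \<inter> \<tau> = {}" "\<sigma> \<union> \<tau> \<in> X"
    by (auto simp: link_def)
  show "finite \<tau>"
    using \<tau> assms by (auto simp: simplicial_complex_def)
  fix \<rho> assume "\<rho> \<subseteq> \<tau>"
  moreover from this have "\<rho> \<in> X" "\<sigma> \<union> \<rho> \<in> X"
    using \<tau> assms(1) unfolding simplicial_complex_def by (meson Un_mono subset_refl)+
  ultimately show "\<rho> \<in> link X \<sigma>"
    using \<tau> by (auto simp: link_def)
qed

lemma link_empty: "link X {} = X"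
  by (auto simp: link_def)

lemma link_deletion: "v \<notin> \<sigma> \<Longrightarrow> link (deletion X v) \<sigma> = deletion (link X \<sigma>) v"
  by (auto simp: link_def deletion_def)

text \<open>By downward closure, a link taken inside a link is again a link of \<open>X\<close>, so
  a hypothesis on all links of \<open>X\<close> also covers it.\<close>

lemma link_link:
  assumes "simplicial_complex X" "{v} \<in> link X \<sigma>"
  shows "link (link X \<sigma>) {v} = link X (insert v \<sigma>)"
proof -
  have "\<sigma> \<union> \<tau> \<in> X \<and> insert v \<tau> \<in> X" if "insert v \<sigma> \<union> \<tau> \<in> X" for \<tau>
  proof -
    have "\<sigma> \<union> \<tau> \<subseteq> insert v \<sigma> \<union> \<tau>" "insert v \<tau> \<subseteq> insert v \<sigma> \<union> \<tau>" by auto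
    with that assms(1) show ?thesis unfolding simplicial_complex_def by meson
  qed
  with assms(2) show ?thesis
    by (auto simp: link_def)
qed

lemma deletion_nonvertex:
  assumes "simplicial_complex X" "{v} \<notin> X"
  shows "deletion X v = X"
proof -
  have "{v} \<in> X" if "\<sigma> \<in> X" "v \<in> \<sigma>" for \<sigma>
    using assms(1) that unfolding simplicial_complex_def by (meson empty_subsetI insert_subset)
  with assms(2) show ?thesis by (auto simp: deletion_def)
qed

lemma link_vertex_subset_deletion: "link X {v} \<subseteq> deletion X v"
  by (auto simp: link_def deletion_def)

text \<open>In the splitting \<open>c = v * a + b\<close> into faces with and without
  \<open>v\<close>, this is the coefficient chain \<open>a\<close>.\<close>

lemma oriented_chains_link_vertex:
  assumes "simplicial_complex X" "c \<in> oriented_chains X (i + 1)"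
  shows "(\<lambda>xs. c (v # xs)) \<in> oriented_chains (link X {v}) i"
proof (rule oriented_chainsI)
  fix xs assume "c (v # xs) \<noteq> 0"
  note c = oriented_chains_support[OF assms(2) this]
  moreover have "set xs \<in> X"
    using c(2) assms(1) unfolding simplicial_complex_def by (meson set_subset_Cons)
  ultimately show "distinct xs \<and> set xs \<in> link X {v} \<and> int (length xs) = i + 1"
    by (auto simp: link_def)
next
  fix xs ys x y
  show "c (v # xs @ x # y # ys) = - c (v # xs @ y # x # ys)"
    by (rule oriented_chains_swap[OF assms(2), of "v # xs", unfolded append_Cons])
qed

text \<open>This is the part \<open>b\<close> of the splitting \<open>c = v * a + b\<close>.\<close>

lemma oriented_chains_restrict_deletion:
  assumes "c \<in> oriented_chains X i"
  shows "(\<lambda>xs. if v \<in> set xs then 0 else c xs) \<in> oriented_chains (deletion X v) i"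
proof (rule oriented_chainsI)
  fix xs assume "(if v \<in> set xs then 0 else c xs) \<noteq> 0"
  then show "distinct xs \<and> set xs \<in> deletion X v \<and> int (length xs) = i + 1"
    using oriented_chains_support[OF assms, of xs] by (auto simp: deletion_def split: if_splits)
next
  fix xs ys x y
  show "(if v \<in> set (xs @ x # y # ys) then 0 else c (xs @ x # y # ys)) =
      - (if v \<in> set (xs @ y # x # ys) then 0 else c (xs @ y # x # ys))"
    using oriented_chains_swap[OF assms, of xs x y ys] by auto
qed

text \<open>Exactness of Mayer--Vietoris at the deletion, done by hand: a cycle of the deletion
  bounds some \<open>c\<close> in \<open>X\<close>, and the cone with apex \<open>v\<close>
  contained in \<open>c\<close> is traded for a filling \<open>e\<close> of its base inside the
  link.\<close>

lemma cycles_subset_boundaries_deletion: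
  assumes X: "simplicial_complex X" and v: "{v} \<in> X"
    and "cycles X i \<subseteq> (boundaries X i :: ('v list \<Rightarrow> 'f::field) set)"
    and "cycles (link X {v}) i \<subseteq> (boundaries (link X {v}) i :: ('v list \<Rightarrow> 'f) set)"
  shows "cycles (deletion X v) i \<subseteq> (boundaries (deletion X v) i :: ('v list \<Rightarrow> 'f) set)"
proof
  let ?D = "deletion X v" and ?L = "link X {v}" and ?V = "vertices X"
  have V: "finite ?V" "v \<in> ?V" "vertices ?D \<subseteq> ?V" "vertices ?L \<subseteq> ?V"
    using finite_vertices[OF X] v by (auto simp: vertices_def deletion_def link_def)
  fix z :: "'v list \<Rightarrow> 'f" assume "z \<in> cycles ?D i"
  then have z: "z \<in> oriented_chains ?D i" "bdry_op ?D z = 0"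
    by (auto simp: cycles_def)
  have zX: "z \<in> oriented_chains X i"
    using z(1) oriented_chains_mono[of ?D X i] by (auto simp: deletion_def)
  have "bdry_op X z = bdry_op ?D z"
    by (rule ext) (simp add: bdry_op_superset[OF zX _ V(1)] bdry_op_superset[OF z(1) V(3,1)])
  with zX z(2) have "z \<in> cycles X i"
    by (simp add: cycles_def)
  with assms(3) obtain c where c: "c \<in> oriented_chains X (i + 1)" "z = bdry_op X c"
    by (auto simp: boundaries_def)
  define a where "a = (\<lambda>xs. c (v # xs))"
  have a: "a \<in> oriented_chains ?L i"
    unfolding a_def by (rule oriented_chains_link_vertex[OF X c(1)])
  \<comment> \<open>Moving \<open>v\<close> to the front costs a sign, so \<partial>a at
    \<open>xs\<close> is minus \<partial>c at \<open>v # xs\<close>. This is zero because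
    \<open>z\<close> avoids \<open>v\<close>.\<close>
  have "bdry_op ?L a = 0"
  proof
    fix xs
    have "bdry_op ?L a xs = (\<Sum>w\<in>?V. c (v # w # xs))"
      by (simp add: bdry_op_superset[OF a V(4,1)]) (simp add: a_def)
    also have "\<dots> = (\<Sum>w\<in>?V. - c (w # v # xs))"
      by (rule sum.cong[OF refl]) (rule oriented_chains_swap[OF c(1), of "[]", unfolded append_Nil])
    also have "\<dots> = - z (v # xs)"
      by (simp add: c(2) bdry_op_def sum_negf)
    also have "z (v # xs) = 0"
      using oriented_chains_support(2)[OF z(1), of "v # xs"] by (auto simp: deletion_def)
    finally show "bdry_op ?L a xs = 0 xs" by simp
  qed
  with a assms(4) obtain e where e: "e \<in> oriented_chains ?L (i + 1)" "a = bdry_op ?L e"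
    by (auto simp: cycles_def boundaries_def)
  \<comment> \<open>Write \<open>c = v * a + b\<close>. Adding \<open>\<partial>(v * e)\<close> turns this into \<open>b + e\<close>, which avoids \<open>v\<close>.\<close>
  define b where "b = (\<lambda>xs. if v \<in> set xs then 0 else c xs)"
  have b: "b \<in> oriented_chains ?D (i + 1)"
    unfolding b_def by (rule oriented_chains_restrict_deletion[OF c(1)])
  have eD: "e \<in> oriented_chains ?D (i + 1)"
    by (rule subsetD[OF oriented_chains_mono[OF link_vertex_subset_deletion] e(1)])
  have be: "b + e \<in> oriented_chains ?D (i + 1)"
    by (rule fun_vs.subspace_add[OF subspace_oriented_chains b eD])
  have "z = bdry_op ?D (b + e)"
  proof
    fix xs
    show "z xs = bdry_op ?D (b + e) xs"
    proof (cases "v \<in> set xs")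
      case True
      then have "z xs = 0"
        using oriented_chains_support(2)[OF z(1), of xs] by (auto simp: deletion_def)
      moreover have "(b + e) (w # xs) = 0" for w
        using oriented_chains_support(2)[OF be, of "w # xs"] True by (auto simp: deletion_def)
      ultimately show ?thesis
        by (simp add: bdry_op_def del: plus_fun_apply)
    next
      case False
      have "e (v # xs) = 0"
        using oriented_chains_support(2)[OF eD, of "v # xs"] by (auto simp: deletion_def)
      \<comment> \<open>The summand at \<open>v\<close> is \<open>a xs\<close>, hence \<partial>e;
        the remaining summands give \<partial>b, as \<open>b\<close> is zero on
        \<open>v # xs\<close>.\<close>
      have "z xs = c (v # xs) + (\<Sum>w\<in>?V - {v}. c (w # xs))"
        by (simp add: c(2) bdry_op_def sum.remove[OF V(1,2)])
      also have "(\<Sum>w\<in>?V - {v}. c (w # xs)) = (\<Sum>w\<in>?V - {v}. b (w # xs))"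
        using False by (intro sum.cong) (auto simp: b_def)
      also have "\<dots> = (\<Sum>w\<in>?V. b (w # xs))"
        by (simp add: sum.remove[OF V(1,2)]) (simp add: b_def)
      also have "c (v # xs) = (\<Sum>w\<in>?V. e (w # xs))"
        using fun_cong[OF e(2), of xs] by (simp add: bdry_op_superset[OF e(1) V(4,1)] a_def)
      finally show ?thesis
        by (simp add: bdry_op_superset[OF be V(3,1)] sum.distrib)
    qed
  qed
  with be show "z \<in> boundaries ?D i"
    by (auto simp: boundaries_def)
qed

section \<open>Leray complexes\<close>

text \<open>The Leray property is often stated for induced subcomplexes. The equivalent form with
  links is used because the definition of a ball speaks of links; the face \<open>{}\<close>
  accounts for \<open>X\<close> itself.\<close>

definition leray :: "'f::field itself \<Rightarrow> int \<Rightarrow> 'v set set \<Rightarrow> bool" where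
  "leray F k X \<longleftrightarrow> simplicial_complex X \<and>
     (\<forall>\<sigma>\<in>X. \<forall>i\<ge>k. cycles (link X \<sigma>) i \<subseteq> (boundaries (link X \<sigma>) i :: ('v list \<Rightarrow> 'f) set))"

text \<open>Deletion commutes with taking the link of \<sigma>. If \<open>v\<close> is a vertex of
  that link, its link there is the link of \<open>insert v \<sigma>\<close> in \<open>X\<close>,
  which also has vanishing homology; otherwise nothing is deleted.\<close>

lemma leray_deletion:
  assumes "leray TYPE('f::field) k X"
  shows "leray TYPE('f) k (deletion X v)"
  unfolding leray_def
proof (intro conjI ballI allI impI)
  have van: "cycles (link X \<sigma>) i \<subseteq> (boundaries (link X \<sigma>) i :: ('a list \<Rightarrow> 'f) set)"
    if "\<sigma> \<in> X" "i \<ge> k" for \<sigma> i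
    using assms that by (auto simp: leray_def)
  have X: "simplicial_complex X"
    using assms by (simp add: leray_def)
  then show "simplicial_complex (deletion X v)"
    by (rule simplicial_complex_deletion)
  fix \<sigma> i assume "\<sigma> \<in> deletion X v" and i: "i \<ge> k"
  then have \<sigma>: "\<sigma> \<in> X" "v \<notin> \<sigma>"
    by (auto simp: deletion_def)
  note L = simplicial_complex_link[OF X \<sigma>(1)]
  show "cycles (link (deletion X v) \<sigma>) i \<subseteq> (boundaries (link (deletion X v) \<sigma>) i :: ('a list \<Rightarrow> 'f) set)"
  proof (cases "{v} \<in> link X \<sigma>")
    case True
    then have "insert v \<sigma> \<in> X"
      by (simp add: link_def)
    then have "cycles (link (link X \<sigma>) {v}) i
        \<subseteq> (boundaries (link (link X \<sigma>) {v}) i :: ('a list \<Rightarrow> 'f) set)"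
      unfolding link_link[OF X True] using van i by blast
    then show ?thesis
      unfolding link_deletion[OF \<sigma>(2)]
      by (rule cycles_subset_boundaries_deletion[OF L True van[OF \<sigma>(1) i]])
  next
    case False
    then show ?thesis
      unfolding link_deletion[OF \<sigma>(2)] deletion_nonvertex[OF L False] using van[OF \<sigma>(1) i] by blast
  qed
qed

text \<open>The finitely many vertices outside \<open>A\<close> are deleted one at a time.\<close>

lemma leray_induced:
  assumes "leray TYPE('f::field) k X"
  shows "leray TYPE('f) k {\<sigma> \<in> X. \<sigma> \<subseteq> A}"
proof -
  have "leray TYPE('f) k {\<sigma> \<in> X. \<sigma> \<inter> W = {}}" if "finite W" for W
    using that
  proof induction
    case empty
    then show ?case using assms by simp
  next
    case (insert w W)
    have "{\<sigma> \<in> X. \<sigma> \<inter> insert w W = {}} = deletion {\<sigma> \<in> X. \<sigma> \<inter> W = {}} w"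
      by (auto simp: deletion_def)
    with insert leray_deletion show ?case by metis
  qed
  moreover have "{\<sigma> \<in> X. \<sigma> \<subseteq> A} = {\<sigma> \<in> X. \<sigma> \<inter> (vertices X - A) = {}}"
    by (auto simp: vertices_def)
  moreover have "finite (vertices X - A)"
    using assms finite_vertices by (auto simp: leray_def)
  ultimately show ?thesis by metis
qed

section \<open>The boundary of a simplex\<close>

text \<open>For injective \<open>f\<close>, the sign of the permutation that sorts a list of distinct elements by \<open>f\<close>.\<close>

primrec list_sign :: "('v \<Rightarrow> nat) \<Rightarrow> 'v list \<Rightarrow> 'f::field" where
  "list_sign f [] = 1"
| "list_sign f (x # xs) = (-1) ^ card {y \<in> set xs. f y < f x} * list_sign f xs"

lemma list_sign_nonzero: "list_sign f xs \<noteq> 0"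
  by (induction xs) auto

text \<open>Exactly one of the two orders of \<open>a\<close> and \<open>b\<close> is an inversion;
  all other pairs contribute equally to both sides.\<close>

lemma list_sign_swap:
  assumes "inj_on f (set (xs @ a # b # ys))" "distinct (xs @ a # b # ys)"
  shows "list_sign f (xs @ a # b # ys) = - list_sign f (xs @ b # a # ys)"
  using assms
proof (induction xs)
  case Nil
  have set_insert: "{y. (y = u \<or> y \<in> set ys) \<and> f y < f w} =
      (if f u < f w then insert u {y \<in> set ys. f y < f w} else {y \<in> set ys. f y < f w})" for u w
    by auto
  have "f a \<noteq> f b"
    using Nil by auto
  then consider "f a < f b" | "f b < f a"
    by linarith
  then show ?case
    using Nil by cases (auto simp: set_insert)
next
  case (Cons x xs)
  have "set (xs @ a # b # ys) = set (xs @ b # a # ys)" by auto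
  with Cons show ?case by simp
qed

text \<open>This is the fundamental chain of the simplex, oriented by an arbitrary injective
  numbering of its vertices.\<close>

lemma exists_simplex_chain:
  assumes "finite \<alpha>"
  shows "\<exists>c :: 'v list \<Rightarrow> 'f::field. c \<in> oriented_chains (Pow \<alpha>) (face_dim \<alpha>) \<and>
    (\<forall>xs. c xs \<noteq> 0 \<longleftrightarrow> distinct xs \<and> set xs = \<alpha>)"
proof -
  obtain f :: "'v \<Rightarrow> nat" where f: "inj_on f \<alpha>"
    using finite_imp_inj_to_nat_seg[OF assms] by blast
  define c :: "'v list \<Rightarrow> 'f" where
    "c = (\<lambda>xs. if distinct xs \<and> set xs = \<alpha> then list_sign f xs else 0)"
  have "c xs \<noteq> 0 \<longleftrightarrow> distinct xs \<and> set xs = \<alpha>" for xs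
    by (simp add: c_def list_sign_nonzero)
  moreover have "c \<in> oriented_chains (Pow \<alpha>) (face_dim \<alpha>)"
  proof (rule oriented_chainsI)
    fix xs assume "c xs \<noteq> 0"
    then show "distinct xs \<and> set xs \<in> Pow \<alpha> \<and> int (length xs) = face_dim \<alpha> + 1"
      by (auto simp: c_def face_dim_def distinct_card split: if_splits)
  next
    fix xs ys and a b :: 'v
    have eq: "distinct (xs @ b # a # ys) \<longleftrightarrow> distinct (xs @ a # b # ys)"
      "set (xs @ b # a # ys) = set (xs @ a # b # ys)"
      by auto
    show "c (xs @ a # b # ys) = - c (xs @ b # a # ys)"
    proof (cases "distinct (xs @ a # b # ys) \<and> set (xs @ a # b # ys) = \<alpha>")
      case True
      then have "list_sign f (xs @ a # b # ys) = - (list_sign f (xs @ b # a # ys) :: 'f)"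
        using f by (intro list_sign_swap) auto
      with True show ?thesis
        unfolding c_def eq by (simp only: if_True simp_thms)
    next
      case False
      then show ?thesis
        unfolding c_def eq by (simp only: if_False minus_zero)
    qed
  qed
  ultimately show ?thesis by blast
qed

text \<open>The boundary of the fundamental chain is a nonzero cycle. It cannot bound in the
  boundary complex, which has no faces of the dimension of \<alpha>.\<close>

lemma simplex_boundary_not_acyclic:
  assumes "finite \<alpha>" "\<alpha> \<noteq> {}"
  shows "\<not> cycles {\<sigma>. \<sigma> \<subset> \<alpha>} (face_dim \<alpha> - 1)
    \<subseteq> (boundaries {\<sigma>. \<sigma> \<subset> \<alpha>} (face_dim \<alpha> - 1) :: ('v list \<Rightarrow> 'f::field) set)"
proof
  let ?S = "{\<sigma>. \<sigma> \<subset> \<alpha>}" and ?n = "face_dim \<alpha> - 1"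
  assume sub: "cycles ?S ?n \<subseteq> (boundaries ?S ?n :: ('v list \<Rightarrow> 'f) set)"
  obtain c :: "'v list \<Rightarrow> 'f" where c: "c \<in> oriented_chains (Pow \<alpha>) (face_dim \<alpha>)"
    and supp: "\<And>xs. c xs \<noteq> 0 \<longleftrightarrow> distinct xs \<and> set xs = \<alpha>"
    using exists_simplex_chain[OF assms(1)] by blast
  have P: "simplicial_complex (Pow \<alpha>)"
    using assms(1) by (auto simp: simplicial_complex_def finite_subset)
  have V: "vertices (Pow \<alpha>) = \<alpha>" "vertices ?S \<subseteq> \<alpha>"
    by (auto simp: vertices_def)
  define z where "z = bdry_op (Pow \<alpha>) c"
  have "z \<in> boundaries (Pow \<alpha>) ?n"
    using c by (simp add: z_def boundaries_def)
  then have zP: "z \<in> oriented_chains (Pow \<alpha>) ?n" and dz: "bdry_op (Pow \<alpha>) z = 0"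
    using boundaries_subset_cycles[OF P] unfolding cycles_def by blast+
  \<comment> \<open>The lists in the support of \<open>z\<close> have
    \<open>card \<alpha> - 1\<close> entries, so their sets are proper subsets of \<alpha>.\<close>
  have z: "z \<in> oriented_chains ?S ?n"
  proof (rule oriented_chainsI)
    fix xs assume "z xs \<noteq> 0"
    note s = oriented_chains_support[OF zP this]
    then have "card (set xs) \<noteq> card \<alpha>"
      by (simp add: distinct_card face_dim_def)
    with s show "distinct xs \<and> set xs \<in> ?S \<and> int (length xs) = ?n + 1"
      by auto
  qed (rule oriented_chains_swap[OF zP])
  \<comment> \<open>Both sums are taken over \<alpha>: for a single vertex, \<open>?S\<close> itself
    has no vertices.\<close>
  have "bdry_op ?S z = bdry_op (Pow \<alpha>) z"
    by (rule ext) (simp only: bdry_op_superset[OF z V(2) assms(1)], simp add: bdry_op_def V(1))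
  with z dz have "z \<in> cycles ?S ?n"
    by (simp add: cycles_def)
  with sub obtain e where e: "e \<in> oriented_chains ?S (face_dim \<alpha>)" "z = bdry_op ?S e"
    by (auto simp: boundaries_def)
  have "e xs = 0" for xs
  proof (rule ccontr)
    assume "e xs \<noteq> 0"
    note s = oriented_chains_support[OF e(1) this]
    then have "card (set xs) < card \<alpha>"
      using assms(1) by (simp add: psubset_card_mono)
    with s show False
      by (simp add: distinct_card face_dim_def)
  qed
  then have z0: "z xs = 0" for xs
    by (simp add: e(2) bdry_op_def)
  obtain v where v: "v \<in> \<alpha>"
    using assms(2) by blast
  \<comment> \<open>On an ordering of the facet opposite \<open>v\<close>, only \<open>v\<close>
    extends the list to all of \<alpha>, so the boundary has a single summand and nothing can
    cancel.\<close>
  obtain xs where xs: "set xs = \<alpha> - {v}" "distinct xs"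
    using finite_distinct_list[of "\<alpha> - {v}"] assms(1) by blast
  have "c (w # xs) = 0" if "w \<in> \<alpha> - {v}" for w
    using that xs supp[of "w # xs"] by auto
  then have "z xs = c (v # xs)"
    by (simp add: z_def bdry_op_def V(1) sum.remove[OF assms(1) v])
  moreover have "c (v # xs) \<noteq> 0"
    using xs v by (subst supp) auto
  ultimately show False
    using z0 by simp
qed

section \<open>Missing faces of Leray complexes and of stacked balls\<close>

lemma leray_missing_face:
  assumes "leray TYPE('f::field) k X" "missing_face X \<alpha>"
  shows "face_dim \<alpha> \<le> k"
proof (rule ccontr)
  assume k: "\<not> face_dim \<alpha> \<le> k"
  have X: "simplicial_complex X"
    using assms(1) by (simp add: leray_def)
  have \<alpha>: "\<alpha> \<subseteq> vertices X" "\<alpha> \<notin> X" "\<And>\<beta>. \<beta> \<subset> \<alpha> \<Longrightarrow> \<beta> \<in> X"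
    using assms(2) by (auto simp: missing_face_def)
  have "finite \<alpha>" "\<alpha> \<noteq> {}"
    using \<alpha> X finite_vertices[OF X] by (auto simp: simplicial_complex_def finite_subset)
  moreover have induced: "{\<sigma> \<in> X. \<sigma> \<subseteq> \<alpha>} = {\<sigma>. \<sigma> \<subset> \<alpha>}"
    using \<alpha> by auto
  have "leray TYPE('f) k {\<sigma>. \<sigma> \<subset> \<alpha>}"
    using leray_induced[OF assms(1), of \<alpha>] unfolding induced .
  \<comment> \<open>The link of \<open>{}\<close> is the whole induced complex, and the negated
    bound puts the degree \<open>face_dim \<alpha> - 1\<close> in the range from \<open>k\<close>
    on.\<close>
  moreover have "{} \<in> {\<sigma>. \<sigma> \<subset> \<alpha>}"
    using \<open>\<alpha> \<noteq> {}\<close> by blast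
  ultimately have "cycles {\<sigma>. \<sigma> \<subset> \<alpha>} (face_dim \<alpha> - 1)
      \<subseteq> (boundaries {\<sigma>. \<sigma> \<subset> \<alpha>} (face_dim \<alpha> - 1) :: ('a list \<Rightarrow> 'f) set)"
    using k unfolding leray_def by (metis link_empty zle_diff1_eq not_le)
  with simplex_boundary_not_acyclic[OF \<open>finite \<alpha>\<close> \<open>\<alpha> \<noteq> {}\<close>] show False by blast
qed

lemma leray_k_stacked_ball:
  assumes "k_stacked_ball TYPE('f::field) d k B"
  shows "leray TYPE('f) k B"
  unfolding leray_def
proof (intro conjI ballI allI impI)
  have ball: "homology_ball TYPE('f) (d + 1) B"
    and stacked: "\<And>\<sigma>. \<sigma> \<in> B \<Longrightarrow> face_dim \<sigma> \<le> d - k \<Longrightarrow> acyclic_complex TYPE('f) (link B \<sigma>)"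
    using assms by (auto simp: k_stacked_ball_def ball_boundary_def)
  show B: "simplicial_complex B"
    using ball by (simp add: homology_ball_def)
  fix \<sigma> i assume \<sigma>: "\<sigma> \<in> B" and i: "i \<ge> k"
  have "acyclic_complex TYPE('f) (link B \<sigma>) \<or>
    has_homology_of_sphere TYPE('f) (d - face_dim \<sigma>) (link B \<sigma>) \<and> d - face_dim \<sigma> < k"
  \<comment> \<open>The link condition in \<open>homology_ball\<close> leaves out \<open>{}\<close>,
    where acyclicity of the ball is used instead. As the ball has dimension \<open>d + 1\<close>,
    the sphere dimension for a link is \<open>d - face_dim \<sigma>\<close>.\<close>
  proof (cases "\<sigma> = {} \<or> face_dim \<sigma> \<le> d - k")
    case True
    then show ?thesis
      using stacked[OF \<sigma>] ball by (auto simp: homology_ball_def link_empty)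
  next
    case False
    have "d + 1 - face_dim \<sigma> - 1 = d - face_dim \<sigma>" by simp
    with False \<sigma> ball show ?thesis
      unfolding homology_ball_def by (metis add.commute not_le le_diff_eq)
  qed
  then have "reduced_betti TYPE('f) (link B \<sigma>) i = 0"
    using i by (auto simp: acyclic_complex_def has_homology_of_sphere_def)
  then show "cycles (link B \<sigma>) i \<subseteq> (boundaries (link B \<sigma>) i :: ('a list \<Rightarrow> 'f) set)"
    by (rule cycles_subset_boundaries[OF simplicial_complex_link[OF B \<sigma>]])
qed

theorem lemma2p11:
  fixes B :: "'v set set" and d k :: int
  assumes "k_stacked_ball TYPE('f::field) d k B"
  shows "\<forall>\<alpha>. missing_face B \<alpha> \<longrightarrow> face_dim \<alpha> \<le> k"
  using leray_missing_face[OF leray_k_stacked_ball[OF assms]] by blast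

end
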